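(* Let $A\in\mathbb{R}^{m\times n}$ with $m\ge n$, $b\in\mathbb{R}^m$, let $J=\mathrm{diag}(I_p,-I_q)$ with $p+q=m$, and assume $M=A^TJA$ is positive definite. Let $x=M^{-1}A^TJb$, $r=b-Ax$, and let $L\in\mathbb{R}^{n\times k}$ ($k\le n$) be fixed. When $\mu=\nu=2$ and the parameters $\Psi,\beta,\xi$ are positive real numbers, the partial condition number $\kappa_{2ILS}(A,b)$ of the indefinite least squares problem with respect to $L$ (defined in the context) has the following two equivalent expressions: $$\kappa_{2ILS}(A,b)=\frac{\left\|L^TM^{-1}\left(\Psi^2\|r\|_2^2I_n+\left(\Psi^2\|x\|_2^2+\beta^2\right)A^TA-\Psi^2\left(xr^TA+A^Trx^T\right)\right)M^{-1}L\right\|_2^{1/2}}{\xi}$$ and $$\kappa_{2ILS}(A,b)=\frac{\left\|L^TM^{-1}\left[\Psi\|r\|_2\left(I_n-\tfrac{1}{\|r\|_2^2}A^Trx^T\right),\ -\beta A^T,\ \Psi\|x\|_2A^T\left(I_m-\tfrac{1}{\|r\|_2^2}rr^T\right)\right]\right\|_2}{\xi}.$$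
   Context: The indefinite least squares (ILS) problem is $\min_{x\in\mathbb{R}^n}(b-Ax)^TJ(b-Ax)$; when $A^TJA$ is positive definite its unique solution is $x(A,b)=M^{-1}A^TJb$ with $M=A^TJA$. $\|\cdot\|_2$ is the spectral norm of a matrix or the Euclidean norm of a vector; $\|\cdot\|_F$ is the Frobenius norm; $I_s$ is the identity matrix of order $s$. Let $g(A,b)=L^Tx(A,b)=L^TM^{-1}A^TJb$, where $L$ is not perturbed, with Fréchet derivative $$g'(A,b)\circ(\Delta A,\Delta b)=L^TM^{-1}(\Delta A)^TJr-L^TM^{-1}A^TJ(\Delta A)x+L^TM^{-1}A^TJ\,\Delta b .$$ For positive real parameters $\Psi,\beta,\xi$ (so that the divisions by the parameters are ordinary scalar divisions) and $\mu=\nu=2$ (the Euclidean norm is used on both the data space and the solution space), the partial condition number is $$\kappa_{2ILS}(A,b)=\sup_{(\Delta A,\Delta b)\neq 0}\frac{\left\|g'(A,b)\circ(\Delta A,\Delta b)\right\|_2/\xi}{\sqrt{\|\Delta A\|_F^2/\Psi^2+\|\Delta b\|_2^2/\beta^2}},$$ the supremum being over $\Delta A\in\mathbb{R}^{m\times n}$, $\Delta b\in\mathbb{R}^m$. *)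

theory Defs
  imports "HOL-Analysis.Analysis"
begin

(* The order on the index type only serves to make "the first p coordinates" meaningful. *)
definition signature_matrix :: "nat \<Rightarrow> real^('m::{finite,linorder})^('m::{finite,linorder})" where
  "signature_matrix p =
     (\<chi> i j. if i = j then (if card {l. l < i} < p then 1 else -1) else 0)"

definition pos_def_matrix :: "real^'n^'n \<Rightarrow> bool" where
  "pos_def_matrix M \<longleftrightarrow> transpose M = M \<and> (\<forall>v. v \<noteq> 0 \<longrightarrow> v \<bullet> (M *v v) > 0)"

definition spectral_norm :: "real^'c^'r \<Rightarrow> real" where
  "spectral_norm B = onorm (\<lambda>v. B *v v)"

(* The library norm on the type real^'c^'r is the Frobenius norm. *)
lemma norm_matrix_frobenius:
  fixes B :: "real^'c^'r"
  shows "norm B = sqrt (\<Sum>i\<in>UNIV. \<Sum>j\<in>UNIV. (B $ i $ j)\<^sup>2)"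
  by (simp add: norm_vec_def L2_set_def sum_nonneg)

definition outer_product :: "real^'r \<Rightarrow> real^'c \<Rightarrow> real^'c^'r" where
  "outer_product u v = (\<chi> i j. u $ i * v $ j)"

definition hblock :: "real^'a^'r \<Rightarrow> real^'b^'r \<Rightarrow> real^('a + 'b)^'r" where
  "hblock B C = (\<chi> i j. case j of Inl s \<Rightarrow> B $ i $ s | Inr t \<Rightarrow> C $ i $ t)"

definition ils_solution :: "real^'m^'m \<Rightarrow> real^'n^'m \<Rightarrow> real^'m \<Rightarrow> real^'n" where
  "ils_solution J A b = matrix_inv (transpose A ** J ** A) *v (transpose A *v (J *v b))"

definition ils_map :: "real^'m^'m \<Rightarrow> real^'k^'n \<Rightarrow> (real^'n^'m) \<times> (real^'m) \<Rightarrow> real^'k" where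
  "ils_map J L = (\<lambda>(A, b). transpose L *v ils_solution J A b)"

definition partial_cond_ils ::
    "real^'m^'m \<Rightarrow> real^'k^'n \<Rightarrow> real \<Rightarrow> real \<Rightarrow> real \<Rightarrow> real^'n^'m \<Rightarrow> real^'m \<Rightarrow> real" where
  "partial_cond_ils J L \<Psi> \<beta> \<xi> A b =
     (SUP (dA, db) \<in> {d. d \<noteq> 0}.
        (norm (frechet_derivative (ils_map J L) (at (A, b)) (dA, db)) / \<xi>) /
        sqrt ((norm dA)\<^sup>2 / \<Psi>\<^sup>2 + (norm db)\<^sup>2 / \<beta>\<^sup>2))"

end

theory Submission
  imports Defs
begin

text \<open>
  After rescaling the data by the parameters, the condition number is the operator norm of a linear
  map \<open>G\<close> between Euclidean spaces, namely of the rescaled derivative. An operator norm satisfies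
  \<open>\<parallel>G\<parallel>\<^sup>2 = \<parallel>G G\<^sup>*\<parallel>\<close>, and because \<open>J\<close> is symmetric with \<open>J\<^sup>2 = I\<close>, all occurrences of \<open>J\<close> cancel in
  \<open>G G\<^sup>*\<close>, which becomes the matrix \<open>L\<^sup>T M\<^sup>-\<^sup>1 S M\<^sup>-\<^sup>1 L\<close> of the first expression. The block
  matrix \<open>H\<close> of the second expression satisfies \<open>H H\<^sup>T = S\<close>, so the same identity applied to
  \<open>L\<^sup>T M\<^sup>-\<^sup>1 H\<close> yields the second expression.
\<close>

section \<open>Matrix norms\<close>

lemma norm_matrix_vector_mult_le:
  fixes A :: "real^'n^'m"
  shows "norm (A *v x) \<le> norm A * norm x"
proof -
  have "norm (A *v x) = L2_set (\<lambda>i. \<bar>A $ i \<bullet> x\<bar>) UNIV"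
    by (simp add: norm_vec_def matrix_vector_mult_def inner_vec_def)
  also have "\<dots> \<le> L2_set (\<lambda>i. norm (A $ i) * norm x) UNIV"
    by (intro L2_set_mono) (auto simp: Cauchy_Schwarz_ineq2)
  also have "\<dots> = norm A * norm x"
    by (simp add: norm_vec_def L2_set_left_distrib L2_set_nonneg)
  finally show ?thesis .
qed

lemma norm_transpose [simp]:
  fixes A :: "real^'n^'m"
  shows "norm (transpose A) = norm A"
  unfolding norm_matrix_frobenius transpose_def by (subst sum.swap) simp

text \<open>Each row of \<open>A ** B\<close> is \<open>transpose B\<close> applied to the same row
  of \<open>A\<close>, so the matrix-vector bound applies row by row. The norm here is the Frobenius
  norm.\<close>

lemma norm_matrix_mult_le:
  fixes A :: "real^'n^'m" and B :: "real^'k^'n"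
  shows "norm (A ** B) \<le> norm A * norm B"
proof -
  have row: "(A ** B) $ i = transpose B *v (A $ i)" for i
    by (simp add: matrix_matrix_mult_def matrix_vector_mult_def transpose_def vec_eq_iff mult.commute)
  have "norm (A ** B) = L2_set (\<lambda>i. norm (transpose B *v (A $ i))) UNIV"
    unfolding norm_vec_def[of "A ** B"] row ..
  also have "\<dots> \<le> L2_set (\<lambda>i. norm (A $ i) * norm B) UNIV"
    by (intro L2_set_mono) (use norm_matrix_vector_mult_le[of "transpose B"] in \<open>simp_all add: mult.commute[of "norm B"]\<close>)
  also have "\<dots> = norm A * norm B"
    by (simp add: norm_vec_def[of A] L2_set_left_distrib L2_set_nonneg)
  finally show ?thesis .
qed

lemma scaleR_matrix_mult_left: "(c *\<^sub>R A) ** B = c *\<^sub>R (A ** (B :: real^'k^'n))" for A :: "real^'n^'m"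
  by (simp add: matrix_matrix_mult_def vec_eq_iff sum_distrib_left mult_ac)

lemma scaleR_matrix_mult_right: "A ** (c *\<^sub>R B) = c *\<^sub>R (A ** (B :: real^'k^'n))" for A :: "real^'n^'m"
  by (simp add: matrix_matrix_mult_def vec_eq_iff sum_distrib_left mult_ac)

lemma matrix_matrix_mult_add_left: "(A + B) ** C = A ** C + B ** (C :: real^'k^'n)" for A :: "real^'n^'m"
  by (simp add: matrix_matrix_mult_def vec_eq_iff distrib_right sum.distrib)

text \<open>Supplies the product rule \<open>mm.FDERIV\<close> and the distributivity rules for
  matrix products.\<close>

lemma bounded_bilinear_matrix_mult:
  "bounded_bilinear ((**) :: real^'n^'m \<Rightarrow> real^'k^'n \<Rightarrow> real^'k^'m)"
proof
  show "\<exists>K. \<forall>(A :: real^'n^'m) (B :: real^'k^'n). norm (A ** B) \<le> norm A * norm B * K"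
    by (intro exI[of _ 1]) (simp add: norm_matrix_mult_le)
qed (simp_all add: matrix_add_ldistrib matrix_matrix_mult_add_left scaleR_matrix_mult_left scaleR_matrix_mult_right)

lemma bounded_bilinear_matrix_vector_mult:
  "bounded_bilinear ((*v) :: real^'n^'m \<Rightarrow> real^'n \<Rightarrow> real^'m)"
proof
  show "\<exists>K. \<forall>(A :: real^'n^'m) x. norm (A *v x) \<le> norm A * norm x * K"
    by (intro exI[of _ 1]) (simp add: norm_matrix_vector_mult_le)
qed (simp_all add: matrix_vector_right_distrib matrix_vector_mult_add_rdistrib
      matrix_vector_mult_scaleR scaleR_matrix_vector_assoc)

lemma bounded_linear_transpose: "bounded_linear (transpose :: real^'n^'m \<Rightarrow> real^'m^'n)"
  by (intro linear_conv_bounded_linear[THEN iffD1])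
    (auto simp: linear_iff transpose_def vec_eq_iff)

interpretation mm: bounded_bilinear "(**) :: real^'n^'m \<Rightarrow> real^'k^'n \<Rightarrow> real^'k^'m"
  by (rule bounded_bilinear_matrix_mult)

interpretation mv: bounded_bilinear "(*v) :: real^'n^'m \<Rightarrow> real^'n \<Rightarrow> real^'m"
  by (rule bounded_bilinear_matrix_vector_mult)

section \<open>The derivative of the matrix inverse\<close>

lemma
  fixes A :: "real^'n^'n"
  assumes "invertible A"
  shows mult_matrix_inv: "A ** matrix_inv A = mat 1"
    and matrix_inv_mult: "matrix_inv A ** A = mat 1"
  using someI_ex[OF assms[unfolded invertible_def]] by (auto simp: matrix_inv_def)

text \<open>A kernel vector \<open>v\<close> of \<open>X\<close> satisfies
  \<open>v = - matrix_inv M *v ((X - M) *v v)\<close>, and the smallness assumption makes the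
  right-hand side strictly shorter than \<open>v\<close> unless \<open>v = 0\<close>.\<close>

lemma invertible_near:
  fixes M X :: "real^'n^'n"
  assumes M: "invertible M" and small: "norm (matrix_inv M) * norm (X - M) < 1"
  shows "invertible X"
proof -
  have "v = 0" if "X *v v = 0" for v
  proof (rule ccontr)
    assume "v \<noteq> 0"
    have "v = matrix_inv M *v (M *v v)"
      by (simp add: matrix_vector_mul_assoc matrix_inv_mult[OF M])
    also have "M *v v = - ((X - M) *v v)"
      by (simp add: that mv.diff_left)
    finally have "norm v = norm (matrix_inv M *v ((X - M) *v v))"
      by (metis mv.minus_right norm_minus_cancel)
    also have "\<dots> \<le> norm (matrix_inv M) * (norm (X - M) * norm v)"
      by (meson norm_matrix_vector_mult_le mult_left_mono norm_ge_zero order_trans)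
    also have "\<dots> < norm v"
      using mult_strict_right_mono[OF small, of "norm v"] \<open>v \<noteq> 0\<close> by (simp add: mult.assoc)
    finally show False by simp
  qed
  then have "inj ((*v) X)"
    by (simp add: linear_injective_0)
  then show ?thesis
    by (metis matrix_left_invertible_injective invertible_left_inverse)
qed

text \<open>With \<open>N\<close> and \<open>Y\<close> the inverses of \<open>M\<close> and
  \<open>X\<close>, the identities
  \<open>Y - N = - (Y ** (X - M) ** N) = - (N ** (X - M) ** Y)\<close> show that the first-order
  remainder is quadratic in \<open>X - M\<close>.\<close>

lemma has_derivative_matrix_inv:
  fixes M :: "real^'n^'n"
  assumes M: "invertible M"
  shows "(matrix_inv has_derivative (\<lambda>H. - (matrix_inv M ** H ** matrix_inv M))) (at M)"
proof -
  define N where "N = matrix_inv M"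
  \<comment> \<open>This radius forces \<open>norm N * norm (X - M)\<close> to be at most 1/2; the
    summand 1 keeps the denominator positive without any lower bound on
    \<open>norm N\<close>.\<close>
  define e where "e = 1 / (2 * norm N + 1)"
  have N: "M ** N = mat 1" "N ** M = mat 1"
    using mult_matrix_inv[OF M] matrix_inv_mult[OF M] by (simp_all add: N_def)
  have bound: "norm (matrix_inv X - N - - (N ** (X - M) ** N)) / norm (X - M)
      \<le> 2 * norm N ^ 3 * norm (X - M)" if d: "dist X M < e" and ne: "X \<noteq> M" for X
  proof -
    define Y where "Y = matrix_inv X"
    have small: "norm N * norm (X - M) \<le> 1 / 2"
    proof -
      have "norm N * norm (X - M) \<le> norm N * e"
        using d by (intro mult_left_mono) (simp_all add: dist_norm)
      also have "\<dots> \<le> 1 / 2"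
        using norm_ge_zero[of N] unfolding e_def by (simp add: field_simps add_pos_nonneg)
      finally show ?thesis .
    qed
    then have inv: "invertible X"
      using invertible_near[OF M, of X] by (simp add: N_def)
    have X: "X ** Y = mat 1" "Y ** X = mat 1"
      using mult_matrix_inv[OF inv] matrix_inv_mult[OF inv] by (simp_all add: Y_def)
    have l: "Y - N = - (Y ** (X - M) ** N)"
      by (simp add: mm.diff_left mm.diff_right X N flip: matrix_mul_assoc)
    have r: "Y - N = - (N ** (X - M) ** Y)"
      by (simp add: mm.diff_left mm.diff_right X N flip: matrix_mul_assoc)
    \<comment> \<open>The bound on \<open>Y\<close> is self-referential: half of
      \<open>norm Y\<close> reappears on the right and is absorbed on the left.\<close>
    have "norm Y \<le> norm N + norm (Y ** (X - M) ** N)"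
      using norm_triangle_sub[of Y N] by (simp add: l)
    also have "norm (Y ** (X - M) ** N) \<le> norm Y * norm (X - M) * norm N"
      by (meson norm_matrix_mult_le mult_right_mono norm_ge_zero order_trans)
    also have "\<dots> \<le> norm Y * (1 / 2)"
      using mult_left_mono[OF small, of "norm Y"] by (simp add: mult_ac)
    finally have Y: "norm Y \<le> 2 * norm N" by simp
    \<comment> \<open>Inserting one identity into the other leaves
      \<open>N ** (X - M) ** Y ** (X - M) ** N\<close>, which contains the factor
      \<open>X - M\<close> twice.\<close>
    have "Y - N - - (N ** (X - M) ** N) = - (N ** (X - M) ** (Y - N))"
      by (subst r) (simp add: mm.diff_right)
    also have "\<dots> = N ** (X - M) ** (Y ** (X - M) ** N)"
      by (simp add: l mm.minus_right)
    finally have "norm (Y - N - - (N ** (X - M) ** N))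
        \<le> norm N * norm (X - M) * (norm Y * norm (X - M) * norm N)"
      by (simp only:) (intro order_trans[OF norm_matrix_mult_le] mult_mono norm_matrix_mult_le
        mult_nonneg_nonneg norm_ge_zero order_refl)
    also have "\<dots> \<le> norm N * norm (X - M) * (2 * norm N * norm (X - M) * norm N)"
      by (intro mult_left_mono mult_right_mono Y) simp_all
    finally show ?thesis
      using ne by (simp add: Y_def divide_simps power3_eq_cube power2_eq_square mult_ac)
  qed
  show ?thesis
    unfolding N_def[symmetric]
  proof (rule has_derivativeI_sandwich[where e = e and H = "\<lambda>X. 2 * norm N ^ 3 * norm (X - M)"])
    show "0 < e" by (simp add: e_def add_nonneg_pos)
    show "bounded_linear (\<lambda>H. - (N ** H ** N))"
      by (rule bounded_linear_minus[OF bounded_linear_compose[OF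
            mm.bounded_linear_left mm.bounded_linear_right]])
    show "((\<lambda>X. 2 * norm N ^ 3 * norm (X - M)) \<longlongrightarrow> 0) (at M)"
      by (auto intro!: tendsto_eq_intros)
  qed (use bound N_def in auto)
qed

section \<open>Operator norms and adjoints\<close>

text \<open>For \<open>\<le>\<close>, the adjoint is bounded first through
  \<open>(norm (?g y))\<^sup>2 = y \<bullet> f (?g y)\<close>, then \<open>f\<close> through
  \<open>(norm (f x))\<^sup>2 = x \<bullet> ?g (f x)\<close>. For \<open>\<ge>\<close>, the adjoint
  has norm at most that of \<open>f\<close>, and operator norms are submultiplicative.\<close>

lemma onorm_eq_sqrt_onorm_comp_adjoint:
  fixes f :: "'a::euclidean_space \<Rightarrow> 'b::euclidean_space"
  assumes f: "linear f"
  shows "onorm f = sqrt (onorm (f \<circ> adjoint f))"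
proof (rule antisym)
  let ?g = "adjoint f"
  have g: "linear ?g" using f by (rule adjoint_linear)
  have bl: "bounded_linear f" "bounded_linear ?g" "bounded_linear (f \<circ> ?g)"
    using f g by (auto simp: linear_conv_bounded_linear intro: bounded_linear_compose simp: o_def)
  \<comment> \<open>Cancels a common factor that may be zero.\<close>
  have sq: "x \<le> c" if "x * x \<le> c * x" "0 \<le> x" "0 \<le> c" for x c :: real
    using that by (cases "x = 0") auto
  have "norm (f x) \<le> sqrt (onorm (f \<circ> ?g)) * norm x" for x
  proof -
    have "(norm (?g (f x)))\<^sup>2 = f x \<bullet> f (?g (f x))"
      by (simp add: power2_norm_eq_inner adjoint_clauses[OF f] inner_commute)
    also have "\<dots> \<le> norm (f x) * norm ((f \<circ> ?g) (f x))"
      by (simp add: norm_cauchy_schwarz)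
    also have "\<dots> \<le> norm (f x) * (onorm (f \<circ> ?g) * norm (f x))"
      by (intro mult_left_mono onorm bl) simp
    finally have "norm (?g (f x)) \<le> sqrt (onorm (f \<circ> ?g) * (norm (f x))\<^sup>2)"
      by (intro real_le_rsqrt) (simp add: power2_eq_square mult_ac)
    then have *: "norm (?g (f x)) \<le> sqrt (onorm (f \<circ> ?g)) * norm (f x)"
      by (simp add: real_sqrt_mult)
    have "norm (f x) * norm (f x) = x \<bullet> ?g (f x)"
      by (simp add: adjoint_works[OF f] flip: power2_norm_eq_inner power2_eq_square)
    also have "\<dots> \<le> norm x * norm (?g (f x))" by (rule norm_cauchy_schwarz)
    also have "\<dots> \<le> norm x * (sqrt (onorm (f \<circ> ?g)) * norm (f x))"
      by (intro mult_left_mono *) simp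
    finally show ?thesis
      by - (rule sq, auto simp: mult_ac onorm_pos_le bl)
  qed
  then show "onorm f \<le> sqrt (onorm (f \<circ> ?g))"
    by (rule onorm_le)
  have "norm (?g y) \<le> onorm f * norm y" for y
  proof -
    have "norm (?g y) * norm (?g y) = ?g y \<bullet> ?g y"
      by (simp add: dot_square_norm power2_eq_square)
    also have "\<dots> = y \<bullet> f (?g y)" by (rule adjoint_clauses[OF f])
    also have "\<dots> \<le> norm y * norm (f (?g y))" by (rule norm_cauchy_schwarz)
    also have "\<dots> \<le> norm y * (onorm f * norm (?g y))"
      by (intro mult_left_mono onorm bl) simp
    finally show ?thesis
      by - (rule sq, auto simp: mult_ac onorm_pos_le bl)
  qed
  then have "onorm ?g \<le> onorm f" by (rule onorm_le)
  then have "onorm (f \<circ> ?g) \<le> (onorm f)\<^sup>2"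
    unfolding power2_eq_square
    by (intro order_trans[OF onorm_compose[OF bl(1,2)]] mult_left_mono onorm_pos_le bl)
  then show "sqrt (onorm (f \<circ> ?g)) \<le> onorm f"
    using onorm_pos_le[OF bl(1)] by (simp add: real_le_lsqrt)
qed

lemma spectral_norm_eq_sqrt:
  fixes B :: "real^'c^'r"
  shows "spectral_norm B = sqrt (spectral_norm (B ** transpose B))"
  using onorm_eq_sqrt_onorm_comp_adjoint[OF matrix_vector_mul_linear, of B]
  by (simp add: spectral_norm_def adjoint_matrix o_def matrix_vector_mul_assoc
      del: transpose_matrix_vector)

section \<open>Block, rank-one and signature matrices\<close>

text \<open>This rule turns \<open>transpose A *v u\<close> into \<open>u v* A\<close>, which would
  hide the transposes from the rewriting below.\<close>

declare transpose_matrix_vector [simp del]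

lemma inner_transpose_mult_vec: "(transpose A *v u) \<bullet> w = u \<bullet> (A *v w)"
  for A :: "real^'n^'m"
  by (simp add: transpose_matrix_vector dot_lmul_matrix)

lemma transpose_diff: "transpose (A - B) = transpose A - transpose B"
  by (simp add: transpose_def vec_eq_iff)

lemma transpose_minus: "transpose (- A) = - transpose A" for A :: "real^'n^'m"
  by (simp add: transpose_def vec_eq_iff)

lemma transpose_scaleR: "transpose (c *\<^sub>R A) = c *\<^sub>R transpose A"
  by (simp add: transpose_def vec_eq_iff)

lemma outer_product_mult_vec: "outer_product u v *v w = (v \<bullet> w) *\<^sub>R u"
  by (simp add: outer_product_def matrix_vector_mult_def inner_vec_def vec_eq_iff sum_distrib_left mult_ac)

lemma transpose_outer_product: "transpose (outer_product u v) = outer_product v u"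
  by (simp add: outer_product_def transpose_def vec_eq_iff mult.commute)

text \<open>Lets the matrix component of an adjoint be read off: a functional
  \<open>u \<bullet> (D *v v)\<close> of \<open>D\<close> is represented, in the Frobenius inner
  product, by a rank-one matrix.\<close>

lemma inner_outer_product: "D \<bullet> outer_product u v = u \<bullet> (D *v v)"
  by (simp add: outer_product_def inner_vec_def matrix_vector_mult_def sum_distrib_left mult_ac)

lemma hblock_mult_transpose:
  fixes B :: "real^'a^'r" and C :: "real^'b^'r"
  shows "hblock B C ** transpose (hblock B C) = B ** transpose B + C ** transpose C"
  by (simp add: hblock_def matrix_matrix_mult_def transpose_def vec_eq_iff sum.Plus
      UNIV_Plus_UNIV[symmetric] del: UNIV_Plus_UNIV)

lemma signature_matrix_symmetric: "transpose (signature_matrix p) = signature_matrix p"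
  by (auto simp: signature_matrix_def transpose_def vec_eq_iff)

lemma signature_matrix_involution: "signature_matrix p ** signature_matrix p = mat 1"
proof -
  have "(\<Sum>k\<in>UNIV. signature_matrix p $ i $ k * signature_matrix p $ k $ j) =
      (\<Sum>k\<in>UNIV. if k = i then (if i = j then 1 else 0) else 0)" for i j :: 'a
    by (intro sum.cong) (auto simp: signature_matrix_def)
  then show ?thesis
    by (simp add: matrix_matrix_mult_def mat_def vec_eq_iff)
qed

lemma pos_def_matrix_invertible:
  fixes M :: "real^'n^'n"
  assumes "pos_def_matrix M"
  shows "invertible M"
proof -
  have "inj ((*v) M)"
    using assms by (force simp: linear_injective_0 pos_def_matrix_def)
  then show ?thesis
    by (metis matrix_left_invertible_injective invertible_left_inverse)
qed

text \<open>Transposing \<open>M ** matrix_inv M = mat 1\<close> exhibits the transpose as a left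
  inverse of \<open>M\<close>, and a left inverse equals the two-sided one.\<close>

lemma transpose_matrix_inv_symmetric:
  fixes M :: "real^'n^'n"
  assumes "invertible M" "transpose M = M"
  shows "transpose (matrix_inv M) = matrix_inv M"
proof -
  have "transpose (matrix_inv M) ** M = mat 1"
    using arg_cong[OF mult_matrix_inv[OF assms(1)], of transpose] by (simp add: matrix_transpose_mul assms)
  then have "transpose (matrix_inv M) ** (M ** matrix_inv M) = matrix_inv M"
    by (simp add: matrix_mul_assoc)
  then show ?thesis by (simp add: mult_matrix_inv[OF assms(1)])
qed

section \<open>The derivative of the least squares map\<close>

text \<open>The product rule combined with the derivative of the inverse yields the formula for g'
  in terms of the residual.\<close>

lemma has_derivative_ils_map:
  fixes A :: "real^'n^'m" and J :: "real^'m^'m" and L :: "real^'k^'n" and b :: "real^'m"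
  assumes "invertible (transpose A ** J ** A)"
  defines "N \<equiv> matrix_inv (transpose A ** J ** A)"
  defines "x \<equiv> N *v (transpose A *v (J *v b))"
  defines "r \<equiv> b - A *v x"
  shows "(ils_map J L has_derivative (\<lambda>(dA, db). transpose L *v (N *v
           (transpose dA *v (J *v r) - transpose A *v (J *v (dA *v x)) + transpose A *v (J *v db)))))
         (at (A, b))"
proof -
  have dT: "((\<lambda>z. transpose (fst z)) has_derivative (\<lambda>h. transpose (fst h))) (at (A, b))"
    by (intro bounded_linear.has_derivative[OF bounded_linear_transpose] has_derivative_fst has_derivative_ident)
  have dM: "((\<lambda>z. transpose (fst z) ** J ** fst z) has_derivative
      (\<lambda>h. transpose A ** J ** fst h + transpose (fst h) ** J ** A)) (at (A, b))"
    using mm.FDERIV[OF bounded_linear.has_derivative[OF mm.bounded_linear_left dT]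
        has_derivative_fst[OF has_derivative_ident]] by simp
  have "(matrix_inv has_derivative (\<lambda>H. - (N ** H ** N))) (at (transpose A ** J ** A))"
    unfolding N_def by (rule has_derivative_matrix_inv) fact
  then have dI: "((\<lambda>z. matrix_inv (transpose (fst z) ** J ** fst z)) has_derivative
      (\<lambda>h. - (N ** (transpose A ** J ** fst h + transpose (fst h) ** J ** A) ** N))) (at (A, b))"
    using has_derivative_compose[OF dM] by simp
  have dc: "((\<lambda>z. transpose (fst z) *v (J *v snd z)) has_derivative
      (\<lambda>h. transpose A *v (J *v snd h) + transpose (fst h) *v (J *v b))) (at (A, b))"
    using mv.FDERIV[OF dT bounded_linear.has_derivative[OF mv.bounded_linear_right
        has_derivative_snd[OF has_derivative_ident]]] by simp
  have "((\<lambda>z. transpose L *v (matrix_inv (transpose (fst z) ** J ** fst z) *v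
        (transpose (fst z) *v (J *v snd z)))) has_derivative
      (\<lambda>h. transpose L *v (N *v (transpose A *v (J *v snd h) + transpose (fst h) *v (J *v b)) +
        (- (N ** (transpose A ** J ** fst h + transpose (fst h) ** J ** A) ** N)) *v
          (transpose A *v (J *v b))))) (at (A, b))"
    using bounded_linear.has_derivative[OF mv.bounded_linear_right mv.FDERIV[OF dI dc]]
    by (simp add: N_def)
  \<comment> \<open>Differentiating the inverse contributes
    \<open>- (transpose dA *v (J *v (A *v x)))\<close>, which joins
    \<open>transpose dA *v (J *v b)\<close> to form the residual term.\<close>
  moreover have "N *v (transpose A *v (J *v db) + transpose dA *v (J *v b)) +
        (- (N ** (transpose A ** J ** dA + transpose dA ** J ** A) ** N)) *v
          (transpose A *v (J *v b)) =
      N *v (transpose dA *v (J *v r) - transpose A *v (J *v (dA *v x)) + transpose A *v (J *v db))"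
    for dA db
  proof -
    have "(- (N ** (transpose A ** J ** dA + transpose dA ** J ** A) ** N)) *v
          (transpose A *v (J *v b)) =
        - (N *v (transpose A *v (J *v (dA *v x)) + transpose dA *v (J *v (A *v x))))"
      by (simp add: x_def mv.minus_left mv.add_left flip: matrix_vector_mul_assoc)
    then show ?thesis
      by (simp add: r_def mv.add_right mv.diff_right)
  qed
  ultimately show ?thesis
    by (simp add: ils_map_def ils_solution_def case_prod_unfold)
qed

lemma bounded_linear_scaled_pair:
  assumes T: "bounded_linear T"
  shows "bounded_linear (\<lambda>(x, y). T (a *\<^sub>R x, c *\<^sub>R y))"
proof -
  have "bounded_linear (\<lambda>z. T (a *\<^sub>R fst z, c *\<^sub>R snd z))"
    by (intro bounded_linear_compose[OF T] bounded_linear_Pair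
        bounded_linear_scaleR_right[THEN bounded_linear_compose] bounded_linear_fst bounded_linear_snd)
  then show ?thesis
    by (simp add: case_prod_unfold)
qed

section \<open>The condition number as an operator norm\<close>

text \<open>Substituting \<open>\<Psi> *\<^sub>R dA\<close> and \<open>\<beta> *\<^sub>R db\<close>
  turns the weighted denominator into the Euclidean norm of the pair \<open>(dA, db)\<close>, so the
  supremum becomes that of an operator norm.\<close>

lemma partial_cond_ils_eq_onorm:
  fixes A :: "real^'n^'m"
  assumes T: "(ils_map J L has_derivative T) (at (A, b))"
    and pos: "\<Psi> > 0" "\<beta> > 0" "\<xi> > 0"
  shows "partial_cond_ils J L \<Psi> \<beta> \<xi> A b = onorm (\<lambda>(dA, db). T (\<Psi> *\<^sub>R dA, \<beta> *\<^sub>R db)) / \<xi>"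
proof -
  define G where "G = (\<lambda>(dA, db). T (\<Psi> *\<^sub>R dA, \<beta> *\<^sub>R db))"
  define R where "R = (\<lambda>(dA, db). norm (T (dA, db)) / \<xi> /
      sqrt ((norm dA)\<^sup>2 / \<Psi>\<^sup>2 + (norm db)\<^sup>2 / \<beta>\<^sup>2))"
  have G: "bounded_linear G"
    unfolding G_def by (rule bounded_linear_scaled_pair[OF has_derivative_bounded_linear[OF T]])
  have R_eq: "R (\<Psi> *\<^sub>R dA, \<beta> *\<^sub>R db) = norm (G (dA, db)) / norm (dA, db) / \<xi>" for dA db
    using pos by (simp add: R_def G_def norm_Pair power_mult_distrib)
  have "partial_cond_ils J L \<Psi> \<beta> \<xi> A b = Sup (R ` {d. d \<noteq> 0})"
    unfolding partial_cond_ils_def frechet_derivative_at[OF T, symmetric] R_def ..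
  also have "\<dots> = onorm G / \<xi>"
  proof (rule cSup_eq_non_empty)
    \<comment> \<open>A nonzero direction is exhibited, since the supremum is characterised only
      over a nonempty set.\<close>
    obtain i :: 'm where True by blast
    have "(0, axis i 1) \<in> {d :: (real^'n^'m) \<times> (real^'m). d \<noteq> 0}"
      by (simp add: prod_eq_iff axis_eq_0_iff)
    then show "R ` {d. d \<noteq> 0} \<noteq> {}" by blast
  next
    fix y assume "y \<in> R ` {d. d \<noteq> 0}"
    then obtain dA db where "y = R (dA, db)" by auto
    then have "y = norm (G (dA /\<^sub>R \<Psi>, db /\<^sub>R \<beta>)) / norm (dA /\<^sub>R \<Psi>, db /\<^sub>R \<beta>) / \<xi>"
      using pos R_eq[of "dA /\<^sub>R \<Psi>" "db /\<^sub>R \<beta>"] by simp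
    then show "y \<le> onorm G / \<xi>"
      using divide_right_mono[OF le_onorm[OF G]] pos by simp
  next
    fix y assume y: "\<And>a. a \<in> R ` {d. d \<noteq> 0} \<Longrightarrow> a \<le> y"
    have "norm (G z) \<le> \<xi> * y * norm z" if "z \<noteq> 0" for z
    proof -
      have "R (\<Psi> *\<^sub>R fst z, \<beta> *\<^sub>R snd z) \<le> y"
        using pos that by (intro y imageI) (auto simp: prod_eq_iff)
      then show ?thesis
        using pos that by (simp add: R_eq pos_divide_le_eq mult_ac)
    qed
    then have "norm (G z) \<le> \<xi> * y * norm z" for z
      by (cases "z = 0") (simp_all add: linear_0 bounded_linear.linear[OF G])
    then have "onorm G \<le> \<xi> * y" by (rule onorm_le)
    then show "onorm G / \<xi> \<le> y"
      using pos by (simp add: pos_divide_le_eq mult_ac)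
  qed
  finally show ?thesis by (simp add: G_def)
qed

theorem theorem3p2:
  fixes A :: "real^'n^('m::{finite,linorder})" and b r :: "real^('m::{finite,linorder})"
    and J :: "real^('m::{finite,linorder})^('m::{finite,linorder})" and M :: "real^'n^'n" and x :: "real^'n"
    and L :: "real^'k^'n" and p q :: nat and \<Psi> \<beta> \<xi> :: real
  assumes "CARD('n) \<le> CARD('m)" and "CARD('k) \<le> CARD('n)" and "p + q = CARD('m)"
    and "J = signature_matrix p"
    and "M = transpose A ** J ** A" and "pos_def_matrix M"
    and "x = matrix_inv M *v (transpose A *v (J *v b))" and "r = b - A *v x"
    and "\<Psi> > 0" and "\<beta> > 0" and "\<xi> > 0"
  shows "partial_cond_ils J L \<Psi> \<beta> \<xi> A b =
           sqrt (spectral_norm (transpose L ** matrix_inv M **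
             ((\<Psi>\<^sup>2 * (norm r)\<^sup>2) *\<^sub>R mat 1
              + (\<Psi>\<^sup>2 * (norm x)\<^sup>2 + \<beta>\<^sup>2) *\<^sub>R (transpose A ** A)
              - \<Psi>\<^sup>2 *\<^sub>R (outer_product x r ** A + transpose A ** outer_product r x))
             ** matrix_inv M ** L)) / \<xi>
       \<and> partial_cond_ils J L \<Psi> \<beta> \<xi> A b =
           spectral_norm (transpose L ** matrix_inv M **
             hblock ((\<Psi> * norm r) *\<^sub>R
                       (mat 1 - (1 / (norm r)\<^sup>2) *\<^sub>R (transpose A ** outer_product r x)))
               (hblock (- \<beta> *\<^sub>R transpose A)
                  ((\<Psi> * norm x) *\<^sub>R
                    (transpose A ** (mat 1 - (1 / (norm r)\<^sup>2) *\<^sub>R outer_product r r))))) / \<xi>"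
    (is "?\<kappa> = sqrt (spectral_norm (_ ** ?S ** _ ** _)) / _ \<and> _ = spectral_norm (_ ** ?H) / _")
proof -
  define N where "N = matrix_inv M"
  define S where "S = ?S"
  define H where "H = ?H"
  define Q where "Q = transpose L ** N ** S ** N ** L"
  have M: "invertible M" "transpose M = M"
    using assms(6) by (simp_all add: pos_def_matrix_invertible) (simp add: pos_def_matrix_def)
  have N_sym: "transpose N = N"
    unfolding N_def using M by (rule transpose_matrix_inv_symmetric)
  have J_sym: "transpose J = J" and JJ: "J ** J = mat 1"
    by (simp_all add: assms(4) signature_matrix_symmetric signature_matrix_involution)
  have JJ_vec: "J *v (J *v w) = w" for w
    by (simp add: matrix_vector_mul_assoc JJ)
  have J_inner: "(J *v u) \<bullet> w = u \<bullet> (J *v w)" for u w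
    using inner_transpose_mult_vec[of J u w] by (simp add: J_sym)
  \<comment> \<open>Both expressions are compared with \<open>S\<close> through its action on a
    vector, where rank-one matrices reduce to inner products.\<close>
  have S_vec: "S *v v = (\<Psi>\<^sup>2 * (r \<bullet> r)) *\<^sub>R v
      + (\<Psi>\<^sup>2 * (x \<bullet> x) + \<beta>\<^sup>2) *\<^sub>R (transpose A *v (A *v v))
      - \<Psi>\<^sup>2 *\<^sub>R ((r \<bullet> (A *v v)) *\<^sub>R x + (x \<bullet> v) *\<^sub>R (transpose A *v r))" for v
    by (simp add: S_def mv.add_left mv.diff_left mv.scaleR_left power2_norm_eq_inner
        outer_product_mult_vec mv.scaleR_right flip: matrix_vector_mul_assoc)

  define T where "T = (\<lambda>(dA, db). transpose L *v (N *v
      (transpose dA *v (J *v r) - transpose A *v (J *v (dA *v x)) + transpose A *v (J *v db))))"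
  define G where "G = (\<lambda>(dA, db). T (\<Psi> *\<^sub>R dA, \<beta> *\<^sub>R db))"
  have T: "(ils_map J L has_derivative T) (at (A, b))"
    using has_derivative_ils_map[of A J L b] M(1) by (simp add: T_def N_def assms(5,7,8))
  have G: "linear G"
    unfolding G_def
    by (intro bounded_linear.linear bounded_linear_scaled_pair has_derivative_bounded_linear[OF T])
  \<comment> \<open>The candidate comes from moving every factor of \<open>G d \<bullet> u\<close>
    onto \<open>v = N *v (L *v u)\<close> and collecting what is paired with \<open>dA\<close> and
    with \<open>db\<close>.\<close>
  have adj: "adjoint G = (\<lambda>u. let v = N *v (L *v u) in
      (\<Psi> *\<^sub>R (outer_product (J *v r) v - outer_product (J *v (A *v v)) x), \<beta> *\<^sub>R (J *v (A *v v))))"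
  proof (intro adjoint_unique allI)
    fix d :: "(real^'n^'m::{finite,linorder}) \<times> (real^'m::{finite,linorder})" and u :: "real^'k"
    obtain dA db where d: "d = (dA, db)" by fastforce
    define v where "v = N *v (L *v u)"
    have "G d \<bullet> u = (transpose N *v (transpose (\<Psi> *\<^sub>R dA) *v (J *v r)
        - transpose A *v (J *v ((\<Psi> *\<^sub>R dA) *v x)) + transpose A *v (J *v (\<beta> *\<^sub>R db)))) \<bullet> (L *v u)"
      by (simp add: G_def T_def d inner_transpose_mult_vec N_sym)
    also have "\<dots> = \<Psi> * ((J *v r) \<bullet> (dA *v v)) - \<Psi> * ((dA *v x) \<bullet> (J *v (A *v v)))
        + \<beta> * (db \<bullet> (J *v (A *v v)))"
      by (simp add: inner_transpose_mult_vec inner_add_left inner_diff_left J_inner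
          mv.scaleR_left mv.scaleR_right v_def)
    also have "\<dots> = d \<bullet> (\<Psi> *\<^sub>R (outer_product (J *v r) v - outer_product (J *v (A *v v)) x),
        \<beta> *\<^sub>R (J *v (A *v v)))"
      by (simp add: d inner_diff_right inner_outer_product right_diff_distrib inner_commute)
    finally show "G d \<bullet> u = d \<bullet> (let v = N *v (L *v u) in
        (\<Psi> *\<^sub>R (outer_product (J *v r) v - outer_product (J *v (A *v v)) x), \<beta> *\<^sub>R (J *v (A *v v))))"
      by (simp add: v_def Let_def)
  qed
  have "(G \<circ> adjoint G) u = Q *v u" for u
  proof -
    define v where "v = N *v (L *v u)"
    \<comment> \<open>Every \<open>J\<close> of \<open>G\<close> meets a \<open>J\<close> of the
      adjoint: either \<open>J *v (J *v w) = w\<close> applies directly, or symmetry moves one of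
      them across an inner product first.\<close>
    have "(G \<circ> adjoint G) u = transpose L *v (N *v (S *v v))"
      unfolding adj S_vec
      by (simp add: G_def T_def Let_def flip: v_def)
        (simp add: mv.scaleR_left mv.scaleR_right mv.diff_left mv.diff_right mv.add_right
          transpose_scaleR transpose_diff transpose_outer_product outer_product_mult_vec J_inner JJ_vec
          inner_commute algebra_simps power2_eq_square)
    then show ?thesis
      by (simp add: Q_def v_def flip: matrix_vector_mul_assoc)
  qed
  then have "G \<circ> adjoint G = (*v) Q" by (rule ext)
  then have "onorm G = sqrt (spectral_norm Q)"
    using onorm_eq_sqrt_onorm_comp_adjoint[OF G] by (simp add: spectral_norm_def)
  then have \<kappa>: "?\<kappa> = sqrt (spectral_norm Q) / \<xi>"
    using partial_cond_ils_eq_onorm[OF T assms(9-11)] by (simp add: G_def)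

  \<comment> \<open>If $r = 0$, then $1 / \|r\|^2$ is $0$ by convention, and the identity still holds.\<close>
  have "H ** transpose H = S"
  proof (rule matrix_eq[THEN iffD2], rule allI)
    fix v
    show "(H ** transpose H) *v v = S *v v"
      \<comment> \<open>For nonzero \<open>r\<close>, the first block yields the identity term, the
        mixed terms and a multiple of \<open>transpose A ** outer_product r r ** A\<close>. The last
        cancels against the third block, whose factor
        \<open>mat 1 - (1 / (norm r)\<^sup>2) *\<^sub>R outer_product r r\<close> is an orthogonal
        projection.\<close>
      by (cases "r = 0"; simp add: S_vec;
          simp add: H_def hblock_mult_transpose mv.add_left mv.minus_left mv.minus_right transpose_minus
            mv.diff_left mv.scaleR_left mv.scaleR_right mv.diff_right transpose_scaleR transpose_diff
            matrix_transpose_mul transpose_outer_product outer_product_mult_vec power2_eq_square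
            algebra_simps dot_square_norm
            flip: matrix_vector_mul_assoc)
  qed
  \<comment> \<open>Symmetry of \<open>N\<close> makes the transposed factor equal to
    \<open>transpose H ** N ** L\<close>.\<close>
  then have "(transpose L ** N ** H) ** transpose (transpose L ** N ** H) = Q"
    by (metis Q_def N_sym matrix_transpose_mul matrix_mul_assoc transpose_transpose)
  then have "spectral_norm (transpose L ** N ** H) = sqrt (spectral_norm Q)"
    using spectral_norm_eq_sqrt by metis
  with \<kappa> show ?thesis
    by (simp add: Q_def S_def H_def N_def)
qed
end
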